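(* For any $s\in[0,\infty]$ there exists a compact countable metric space $(X,d)$ with a unique cluster point such that $R(X,d)=s$. Indeed, the space $X$ may be taken to be a strictly decreasing sequence in the interval $(0,1]$ with limit $0$, together with its limit point $0$, with the metric inherited from $\mathbb{R}$.
   Context: Logarithmic ratio. A clopen partition of a compact metric space $(X,d)$ is a finite partition $\alpha=\{A_1,\dots,A_n\}$ of $X$ into nonempty clopen sets. Its diameter is $\delta(\alpha)=\max_i \operatorname{diam}(A_i)$ (and $\delta(\alpha)=0$ if $n=0$). Its gap is $\gamma(\alpha)=\min\{d(x,y): x\in A_i,\ y\in A_j,\ i\ne j\}$ if $n>1$, and $\gamma(\alpha)=\operatorname{diam}(X)$ if $n\le 1$ (with $\operatorname{diam}(\emptyset)=0$). Its logarithmic ratio $R(\alpha)\in[0,\infty]$ is $R(\alpha)=\log\gamma(\alpha)/\log\delta(\alpha)$ if $0<\delta(\alpha)<1$ and $\gamma(\alpha)<1$; $R(\alpha)=0$ if $\delta(\alpha)=0$; and $R(\alpha)=+\infty$ if either $0<\delta(\alpha)<1$ and $\gamma(\alpha)\ge 1$, or $\delta(\alpha)\ge 1$. The logarithmic ratio of $(X,d)$ is $$R(X,d)=\lim_{r\to 0^+}\inf\{R(\alpha): \alpha \text{ is a clopen partition of } X \text{ with } \delta(\alpha)<r\}\in[0,\infty],$$ with $\inf\emptyset=+\infty$. *)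

theory Defs
  imports "HOL-Analysis.Analysis"
begin

text \<open>A metric space \<open>(X,d)\<close> is a subset \<open>X\<close> of a type of class \<open>metric_space\<close>, with the inherited
  metric and the subspace topology.\<close>

definition clopen_partition :: "'a::metric_space set \<Rightarrow> 'a set set \<Rightarrow> bool" where
  "clopen_partition X \<alpha> \<longleftrightarrow> finite \<alpha> \<and> partition_on X \<alpha> \<and>
     (\<forall>A\<in>\<alpha>. openin (top_of_set X) A \<and> closedin (top_of_set X) A)"

definition part_diam :: "'a::metric_space set set \<Rightarrow> real" where
  "part_diam \<alpha> = (if \<alpha> = {} then 0 else Max (diameter ` \<alpha>))"

text \<open>For compact \<open>X\<close> the infimum is a minimum, see \<open>part_gap_attained\<close> below.\<close>

definition part_gap :: "'a::metric_space set \<Rightarrow> 'a set set \<Rightarrow> real" where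
  "part_gap X \<alpha> = (if card \<alpha> > 1
     then Inf {dist x y | x y A B. A \<in> \<alpha> \<and> B \<in> \<alpha> \<and> A \<noteq> B \<and> x \<in> A \<and> y \<in> B}
     else diameter X)"

definition part_log_ratio :: "'a::metric_space set \<Rightarrow> 'a set set \<Rightarrow> ereal" where
  "part_log_ratio X \<alpha> =
     (if part_diam \<alpha> = 0 then 0
      else if 0 < part_diam \<alpha> \<and> part_diam \<alpha> < 1 \<and> part_gap X \<alpha> < 1
      then ereal (ln (part_gap X \<alpha>) / ln (part_diam \<alpha>))
      else \<infinity>)"

text \<open>The limit exists by monotonicity, see \<open>log_ratio_tendsto\<close> below.\<close>

definition log_ratio :: "'a::metric_space set \<Rightarrow> ereal" where
  "log_ratio X = Lim (at_right (0::real))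
     (\<lambda>r. Inf {part_log_ratio X \<alpha> | \<alpha>. clopen_partition X \<alpha> \<and> part_diam \<alpha> < r})"

lemma part_gap_attained:
  assumes X: "compact X" and \<alpha>: "clopen_partition X \<alpha>" and card: "card \<alpha> > 1"
  shows "\<exists>A\<in>\<alpha>. \<exists>B\<in>\<alpha>. A \<noteq> B \<and> (\<exists>x\<in>A. \<exists>y\<in>B. part_gap X \<alpha> = dist x y)"
    and "part_gap X \<alpha> > 0"
proof -
  define I where "I = {(A, B). A \<in> \<alpha> \<and> B \<in> \<alpha> \<and> A \<noteq> B}"
  define D where "D = {dist x y | x y A B. A \<in> \<alpha> \<and> B \<in> \<alpha> \<and> A \<noteq> B \<and> x \<in> A \<and> y \<in> B}"
  have fin: "finite \<alpha>" and part: "partition_on X \<alpha>"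
    and cl: "\<And>A. A \<in> \<alpha> \<Longrightarrow> closedin (top_of_set X) A"
    using \<alpha> by (auto simp: clopen_partition_def)
  have cpt: "compact A" if "A \<in> \<alpha>" for A
    using X cl[OF that] by (metis closedin_compact)
  have "finite I"
    by (rule finite_subset[of _ "\<alpha> \<times> \<alpha>"]) (auto simp: I_def fin)
  have D_eq: "D = (\<Union>(A,B)\<in>I. (\<lambda>(x,y). dist x y) ` (A \<times> B))"
    by (auto simp: D_def I_def)
  have "compact D"
    unfolding D_eq
  proof (rule compact_UN[OF \<open>finite I\<close>])
    fix p assume "p \<in> I"
    then show "compact (case p of (A, B) \<Rightarrow> (\<lambda>(x,y). dist x y) ` (A \<times> B))"
      by (auto simp: I_def case_prod_beta intro!: compact_continuous_image continuous_intros compact_Times cpt)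
  qed
  obtain A B where AB: "A \<in> \<alpha>" "B \<in> \<alpha>" "A \<noteq> B"
    using card by (metis card_le_Suc0_iff_eq fin not_less One_nat_def)
  moreover have "{} \<notin> \<alpha>" using part by (auto simp: partition_on_def)
  ultimately obtain x y where "x \<in> A" "y \<in> B" by (metis all_not_in_conv)
  with AB have "D \<noteq> {}" by (auto simp: D_def)
  have "Inf D \<in> D"
    using \<open>compact D\<close> \<open>D \<noteq> {}\<close>
    by (intro closed_contains_Inf) (auto simp: compact_imp_closed bounded_imp_bdd_below compact_imp_bounded)
  moreover have gap: "part_gap X \<alpha> = Inf D"
    using card by (simp add: part_gap_def D_def)
  ultimately obtain A' B' x' y' where *: "A' \<in> \<alpha>" "B' \<in> \<alpha>" "A' \<noteq> B'" "x' \<in> A'" "y' \<in> B'"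
    "part_gap X \<alpha> = dist x' y'"
    by (auto simp: D_def)
  then show "\<exists>A\<in>\<alpha>. \<exists>B\<in>\<alpha>. A \<noteq> B \<and> (\<exists>x\<in>A. \<exists>y\<in>B. part_gap X \<alpha> = dist x y)"
    by blast
  have "A' \<inter> B' = {}"
    using part * by (auto simp: partition_on_def disjoint_def)
  with * show "part_gap X \<alpha> > 0" by auto
qed

lemma log_ratio_tendsto:
  "((\<lambda>r. Inf {part_log_ratio X \<alpha> | \<alpha>. clopen_partition X \<alpha> \<and> part_diam \<alpha> < r})
     \<longlongrightarrow> log_ratio X) (at_right (0::real))"
proof -
  define f where "f r = Inf {part_log_ratio X \<alpha> | \<alpha>. clopen_partition X \<alpha> \<and> part_diam \<alpha> < r}"
    for r :: real
  define L where "L = (SUP r\<in>{0<..}. f r)"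
  have anti: "f r' \<le> f r" if "r \<le> r'" for r r'
    unfolding f_def by (rule Inf_superset_mono) (use that in auto)
  have "(f \<longlongrightarrow> L) (at_right 0)"
  proof (rule order_tendstoI)
    fix a assume "a < L"
    then obtain r where r: "r > 0" "a < f r"
      unfolding L_def by (auto simp: less_SUP_iff)
    have "eventually (\<lambda>t. t < r) (at_right 0)"
      using r(1) by (auto simp: eventually_at_right)
    then show "eventually (\<lambda>t. a < f t) (at_right 0)"
      by eventually_elim (use r(2) anti in \<open>meson less_imp_le less_le_trans\<close>)
  next
    fix a assume "L < a"
    have "f t \<le> L" if "t > 0" for t
      unfolding L_def by (rule SUP_upper) (use that in auto)
    then have "\<And>t. t > 0 \<Longrightarrow> f t < a"
      using \<open>L < a\<close> le_less_trans by blast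
    then show "eventually (\<lambda>t. f t < a) (at_right 0)"
      by (auto simp: eventually_at_filter)
  qed
  moreover from this have "log_ratio X = L"
    unfolding log_ratio_def f_def by (intro tendsto_Lim) auto
  ultimately show ?thesis by (simp add: f_def[abs_def])
qed

end

theory Submission
  imports Defs "HOL-Real_Asymp.Real_Asymp"
begin

text \<open>For a sequence \<open>x\<close> decreasing to \<open>0\<close>, let \<open>A\<close> be the part containing \<open>0\<close> of a clopen partition
  finer than the trivial one, and let \<open>x n\<close> be the smallest point outside \<open>A\<close>. Then \<open>\<delta> \<ge> x (n+1)\<close> and
  \<open>\<gamma> \<le> x n - x (n+1)\<close>, and both are equalities for the partition into \<open>{x 0}, \<dots>, {x n}\<close> and the rest,
  provided that the gaps of \<open>x\<close> decrease. So the logarithmic ratio is the limit of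
  \<open>ln (x n - x (n+1)) / ln (x (n+1))\<close> if this exists. Solving \<open>x (n+1) + \<phi> (x (n+1)) = x n\<close> recursively
  turns this into the limit of \<open>ln (\<phi> y) / ln y\<close> at \<open>0\<close>, for which \<open>\<phi> y = y powr s\<close> gives \<open>s\<close>; the
  extreme values come from \<open>\<phi> y = 1 / (1 - ln y)\<close> and \<open>\<phi> y = exp (- 1 / y)\<close>.\<close>

section \<open>Bounding diameter and gap by single pairs of points\<close>

lemma clopen_partition_diameter_le:
  assumes "bounded X" "clopen_partition X \<alpha>" "A \<in> \<alpha>" "u \<in> A" "v \<in> A"
  shows "dist u v \<le> part_diam \<alpha>"
proof -
  have "A \<subseteq> X" and fin: "finite \<alpha>"
    using assms by (auto simp: clopen_partition_def partition_on_def)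
  then have "dist u v \<le> diameter A"
    using assms by (meson bounded_subset diameter_bounded_bound)
  also have "\<dots> \<le> part_diam \<alpha>"
    using fin assms(3) by (auto simp: part_diam_def)
  finally show ?thesis .
qed

text \<open>Two distinct parts exclude the default gap \<open>diameter X\<close>, so the gap is an
  infimum of distances, which are bounded below by 0.\<close>

lemma clopen_partition_gap_le:
  assumes "A \<in> \<alpha>" "B \<in> \<alpha>" "A \<noteq> B" "u \<in> A" "v \<in> B" "finite \<alpha>"
  shows "card \<alpha> > 1" and "part_gap X \<alpha> \<le> dist u v"
proof -
  show card: "card \<alpha> > 1"
    using assms by (metis One_nat_def card_le_Suc0_iff_eq not_less)
  have "bdd_below {dist x y | x y A B. A \<in> \<alpha> \<and> B \<in> \<alpha> \<and> A \<noteq> B \<and> x \<in> A \<and> y \<in> B}"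
    by (rule bdd_belowI[of _ 0]) auto
  then show "part_gap X \<alpha> \<le> dist u v"
    unfolding part_gap_def using card assms by (auto intro!: cInf_lower)
qed

text \<open>With strict decrease, the bound 1 makes \<open>x (Suc n)\<close> and
  \<open>x n - x (Suc n)\<close> less than 1. Both logarithms are then negative, which keeps the
  ratios in the finite case of \<open>part_log_ratio\<close>.\<close>

locale null_sequence =
  fixes x :: "nat \<Rightarrow> real" and X :: "real set"
  assumes decr: "m < n \<Longrightarrow> x n < x m"
    and pos: "0 < x n"
    and le1: "x n \<le> 1"
    and lim: "x \<longlonglongrightarrow> 0"
  defines "X \<equiv> insert 0 (range x)"
begin

lemma less_iff: "x m < x n \<longleftrightarrow> n < m"
  by (metis decr linorder_cases order_less_asym)

lemma le_iff: "x m \<le> x n \<longleftrightarrow> n \<le> m"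
  by (meson less_iff linorder_not_less)

lemma eq_iff: "x m = x n \<longleftrightarrow> m = n"
  by (metis decr linorder_cases less_irrefl)

lemma compact: "compact X"
  unfolding X_def by (rule compact_sequence_with_limit[OF lim])

lemma openin_singleton: "openin (top_of_set X) {x k}"
proof -
  \<comment> \<open>The ray above \<open>x (Suc k)\<close> excludes 0 and all later terms. The
    earlier terms form a finite, hence closed, set, so \<open>k = 0\<close> needs no separate
    treatment.\<close>
  have "{x k} = X \<inter> ({x (Suc k)<..} \<inter> - x ` {..<k})"
    using pos[of "Suc k"] by (auto simp: X_def less_iff eq_iff)
  moreover have "open ({x (Suc k)<..} \<inter> - x ` {..<k})"
    by (intro open_Int open_greaterThan) (simp add: finite_imp_closed open_Compl)
  ultimately show ?thesis
    by (metis openin_open_Int)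
qed

lemma islimpt_iff: "p \<in> X \<Longrightarrow> p islimpt X \<longleftrightarrow> p = 0"
proof -
  assume p: "p \<in> X"
  have "0 islimpt X"
    unfolding islimpt_sequential
  proof (intro exI[of _ x] conjI allI)
    show "x n \<in> X - {0}" for n using pos[of n] by (auto simp: X_def)
  qed (rule lim)
  moreover have "\<not> x k islimpt X" for k
  proof -
    obtain U where "open U" "{x k} = X \<inter> U"
      using openin_singleton[of k] by (auto simp: openin_open)
    then show ?thesis
      by (auto simp: islimpt_def intro!: exI[of _ U])
  qed
  ultimately show ?thesis using p by (auto simp: X_def)
qed

section \<open>Lower bound for the logarithmic ratio\<close>

lemma partition_bounds:
  assumes \<alpha>: "clopen_partition X \<alpha>" and \<delta>: "part_diam \<alpha> < x N"
  obtains n where "N \<le> n" "x (Suc n) \<le> part_diam \<alpha>" "card \<alpha> > 1"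
    "part_gap X \<alpha> \<le> x n - x (Suc n)"
proof -
  have fin: "finite \<alpha>" and part: "partition_on X \<alpha>"
    and op: "\<And>A. A \<in> \<alpha> \<Longrightarrow> openin (top_of_set X) A"
    using \<alpha> by (auto simp: clopen_partition_def)
  have un: "\<Union>\<alpha> = X" using part by (auto simp: partition_on_def)
  have bnd: "bounded X" by (simp add: compact compact_imp_bounded)
  obtain A where A: "A \<in> \<alpha>" "0 \<in> A" using un by (auto simp: X_def)
  have diam: "x k \<le> part_diam \<alpha>" if "x k \<in> A" for k
    using clopen_partition_diameter_le[OF bnd \<alpha> A that] pos[of k] by simp
  \<comment> \<open>Openness of \<open>A\<close> at the limit point 0 leaves only finitely many
    terms outside \<open>A\<close>.\<close>
  obtain U where U: "open U" "A = X \<inter> U" using op[OF A(1)] by (auto simp: openin_open)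
  have "eventually (\<lambda>n. x n \<in> U) sequentially"
    using lim U A by (auto intro: topological_tendstoD)
  then obtain M where M: "\<And>n. n \<ge> M \<Longrightarrow> x n \<in> A"
    using U by (auto simp: eventually_sequentially X_def)
  let ?S = "{n. x n \<notin> A}"
  have finS: "finite ?S"
    by (rule finite_subset[of _ "{..<M}"]) (use M in \<open>auto simp: not_le[symmetric]\<close>)
  \<comment> \<open>If \<open>x N\<close> were in \<open>A\<close>, its distance to 0 would be at
    most the diameter, which is less than \<open>x N\<close>.\<close>
  have NS: "N \<in> ?S" using diam[of N] \<delta> by auto
  define n where "n = Max ?S"
  have nS: "x n \<notin> A" using Max_in[OF finS] NS n_def by auto
  have Nn: "N \<le> n" using NS finS by (simp add: n_def)
  have SnA: "x (Suc n) \<in> A"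
    using Max_ge[OF finS, of "Suc n"] by (auto simp: n_def[symmetric])
  obtain B where B: "B \<in> \<alpha>" "x n \<in> B" using un by (auto simp: X_def)
  have AB: "B \<noteq> A" using B nS by auto
  have "card \<alpha> > 1" "part_gap X \<alpha> \<le> dist (x n) (x (Suc n))"
    using clopen_partition_gap_le[OF B(1) A(1) AB B(2) SnA fin] by auto
  then show ?thesis
    using that[OF Nn diam[OF SnA]] decr[of n "Suc n"] by (simp add: dist_real_def)
qed

text \<open>Given \<open>c < s\<close>, the ratios exceed \<open>c\<close> from some index
  \<open>N\<close> on. Every partition of diameter below \<open>x N\<close> has ratio at least that
  at some \<open>n \<ge> N\<close>, so the infima are at least \<open>c\<close> for all small
  \<open>r\<close>. Arguing with \<open>c < s\<close> includes
  \<open>s = \<infinity>\<close>.\<close>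

lemma log_ratio_ge:
  assumes q: "((\<lambda>n. ereal (ln (x n - x (Suc n)) / ln (x (Suc n)))) \<longlongrightarrow> s) sequentially"
  shows "s \<le> log_ratio X"
proof (rule dense_le)
  fix c assume "c < s"
  then obtain N where N: "\<And>n. n \<ge> N \<Longrightarrow> c < ereal (ln (x n - x (Suc n)) / ln (x (Suc n)))"
    using order_tendstoD(1)[OF q] by (auto simp: eventually_sequentially)
  have ratio: "c \<le> part_log_ratio X \<alpha>" if \<alpha>: "clopen_partition X \<alpha>" "part_diam \<alpha> < x N" for \<alpha>
  proof -
    obtain n where n: "N \<le> n" "x (Suc n) \<le> part_diam \<alpha>" "card \<alpha> > 1"
      "part_gap X \<alpha> \<le> x n - x (Suc n)"
      using partition_bounds[OF \<alpha>] .
    have gap: "part_gap X \<alpha> > 0" by (rule part_gap_attained(2)[OF compact \<alpha>(1) n(3)])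
    have \<delta>: "0 < part_diam \<alpha>" "part_diam \<alpha> < 1"
      using n(2) pos[of "Suc n"] \<alpha>(2) le1[of N] by linarith+
    have d: "x n - x (Suc n) < 1" using le1[of n] pos[of "Suc n"] by linarith
    \<comment> \<open>Negation makes numerators and denominators nonnegative: a smaller gap
      increases the numerator and a larger diameter decreases the denominator.\<close>
    have "- ln (x n - x (Suc n)) / - ln (x (Suc n)) \<le> - ln (part_gap X \<alpha>) / - ln (part_diam \<alpha>)"
    proof (rule frac_le)
      show "0 < - ln (part_diam \<alpha>)" using \<delta> by simp
      show "- ln (part_diam \<alpha>) \<le> - ln (x (Suc n))" using n(2) pos[of "Suc n"] by simp
      show "- ln (x n - x (Suc n)) \<le> - ln (part_gap X \<alpha>)" using n(4) gap by simp
      show "0 \<le> - ln (part_gap X \<alpha>)" using n(4) gap d by simp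
    qed
    then show ?thesis
      using N[OF n(1)] \<delta> n(4) d
      by (auto simp: part_log_ratio_def intro: order_trans[OF less_imp_le])
  qed
  have "eventually (\<lambda>r. c \<le> Inf {part_log_ratio X \<alpha> |\<alpha>. clopen_partition X \<alpha> \<and> part_diam \<alpha> < r})
     (at_right 0)"
    using eventually_at_right_less[of 0] eventually_at_right_real[OF pos[of N]]
  proof eventually_elim
    case (elim r)
    then show ?case by (auto intro!: Inf_greatest ratio)
  qed
  then show "c \<le> log_ratio X"
    by (rule tendsto_lowerbound[OF log_ratio_tendsto]) simp
qed

section \<open>Upper bound from explicit partitions\<close>

definition tail :: "nat \<Rightarrow> real set" where
  "tail n = insert 0 (x ` {n<..})"

definition cut :: "nat \<Rightarrow> real set set" where
  "cut n = insert (tail n) ((\<lambda>k. {x k}) ` {..n})"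

lemma x_in_tail_iff: "x k \<in> tail n \<longleftrightarrow> n < k"
  using pos[of k] by (auto simp: tail_def eq_iff)

lemma clopen_partition_cut: "clopen_partition X (cut n)"
proof -
  \<comment> \<open>No point of \<open>X\<close> lies strictly between \<open>x (Suc n)\<close> and
    \<open>x n\<close>, so an open and a closed ray cut out the same set.\<close>
  have "tail n = X \<inter> {..<x n}" "tail n = X \<inter> {..x (Suc n)}"
    using pos[of n] pos[of "Suc n"] by (auto simp: tail_def X_def less_iff le_iff)
  then have "openin (top_of_set X) (tail n)" "closedin (top_of_set X) (tail n)"
    by (metis open_lessThan openin_open_Int, metis closed_atMost closedin_closed_Int)
  moreover have "closedin (top_of_set X) {x k}" for k
    by (rule closed_subset) (auto simp: X_def)
  moreover have "partition_on X (cut n)"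
  proof (rule partition_onI)
    show "\<Union>(cut n) = X" by (auto simp: cut_def tail_def X_def) (use not_le in blast)
    show "disjnt p q" if "p \<in> cut n" "q \<in> cut n" "p \<noteq> q" for p q
      using that by (auto simp: cut_def disjnt_def x_in_tail_iff)
    show "{} \<notin> cut n" by (auto simp: cut_def tail_def)
  qed
  ultimately show ?thesis
    using openin_singleton by (auto simp: clopen_partition_def cut_def)
qed

text \<open>Singletons have diameter 0, so the tail decides; its extreme points are 0 and
  \<open>x (Suc n)\<close>.\<close>

lemma part_diam_cut: "part_diam (cut n) = x (Suc n)"
proof (rule antisym)
  have "diameter (tail n) \<le> x (Suc n)"
  proof (rule diameter_le)
    have "0 \<le> u \<and> u \<le> x (Suc n)" if "u \<in> tail n" for u
      using that pos less_imp_le by (auto simp: tail_def le_iff)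
    then show "norm (u - v) \<le> x (Suc n)" if "u \<in> tail n" "v \<in> tail n" for u v
      using that(1,2)[THEN \<open>\<And>u. u \<in> tail n \<Longrightarrow> 0 \<le> u \<and> u \<le> x (Suc n)\<close>] by (auto simp: abs_le_iff)
  qed (use pos less_imp_le in auto)
  then show "part_diam (cut n) \<le> x (Suc n)"
    using pos[of "Suc n"] by (auto simp: part_diam_def cut_def)
  have "dist (x (Suc n)) 0 \<le> part_diam (cut n)"
    by (rule clopen_partition_diameter_le[OF compact_imp_bounded[OF compact] clopen_partition_cut, of "tail n"])
       (auto simp: cut_def tail_def)
  then show "x (Suc n) \<le> part_diam (cut n)" using pos[of "Suc n"] by simp
qed

text \<open>Of two points in different parts, the larger is some \<open>x k\<close> with
  \<open>k \<le> n\<close>, and the next smaller point of \<open>X\<close> is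
  \<open>x (Suc k)\<close>. Their distance is thus at least \<open>x k - x (Suc k)\<close>, which
  \<open>gaps\<close> compares with the last gap.\<close>

lemma part_gap_cut:
  assumes gaps: "\<And>k. k \<le> n \<Longrightarrow> x n - x (Suc n) \<le> x k - x (Suc k)"
  shows "part_gap X (cut n) = x n - x (Suc n)"
proof -
  have fin: "finite (cut n)" by (simp add: cut_def)
  have neq: "{x n} \<noteq> tail n" using x_in_tail_iff[of n n] by auto
  have "card (cut n) > 1" and le: "part_gap X (cut n) \<le> dist (x n) (x (Suc n))"
    using clopen_partition_gap_le[OF _ _ neq _ _ fin, of "x n" "x (Suc n)"]
    by (auto simp: cut_def x_in_tail_iff)
  then obtain A B u v where *: "A \<in> cut n" "B \<in> cut n" "A \<noteq> B" "u \<in> A" "v \<in> B"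
    "part_gap X (cut n) = dist u v"
    using part_gap_attained(1)[OF compact clopen_partition_cut] by metis
  have tl: "x n - x (Suc n) \<le> dist (x k) u" "x n - x (Suc n) \<le> dist u (x k)"
    if "u < x k" "u \<in> X" "k \<le> n" for u k
  proof -
    have "u \<le> x (Suc k)"
      using that pos[of "Suc k"] by (auto simp: X_def less_iff le_iff)
    then show "x n - x (Suc n) \<le> dist (x k) u"
      using gaps[OF that(3)] by (simp add: dist_real_def)
    then show "x n - x (Suc n) \<le> dist u (x k)" by (simp add: dist_commute)
  qed
  have tail: "w < x k" "w \<in> X" if "w \<in> tail n" "k \<le> n" for w k
    using that pos[of k] by (auto simp: tail_def X_def less_iff)
  have pts: "x n - x (Suc n) \<le> dist (x k) (x l)" if "k \<noteq> l" "k \<le> n" "l \<le> n" for k l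
    using that tl[of "x k" l] tl[of "x l" k] by (cases k l rule: linorder_cases) (auto simp: less_iff X_def)
  have "x n - x (Suc n) \<le> dist u v"
    using * by (auto simp: cut_def intro: tl tail pts)
  then show ?thesis
    using * le decr[of n "Suc n"] by (simp add: dist_real_def)
qed

text \<open>As \<open>x (Suc n)\<close> tends to 0, for every \<open>r > 0\<close> some
  \<open>cut n\<close> has diameter below \<open>r\<close> and ratio below a given
  \<open>c > s\<close>.\<close>

lemma log_ratio_le:
  assumes q: "((\<lambda>n. ereal (ln (x n - x (Suc n)) / ln (x (Suc n)))) \<longlongrightarrow> s) sequentially"
    and gaps: "\<And>k n. k \<le> n \<Longrightarrow> x n - x (Suc n) \<le> x k - x (Suc k)"
  shows "log_ratio X \<le> s"
proof (rule dense_ge)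
  fix c assume "s < c"
  have "Inf {part_log_ratio X \<alpha> |\<alpha>. clopen_partition X \<alpha> \<and> part_diam \<alpha> < r} \<le> c" if "r > 0" for r
  proof -
    have "eventually (\<lambda>n. x (Suc n) < r) sequentially"
      using order_tendstoD(2)[OF LIMSEQ_Suc[OF lim] that] .
    then have "eventually (\<lambda>n. x (Suc n) < r \<and> ereal (ln (x n - x (Suc n)) / ln (x (Suc n))) < c)
       sequentially"
      using order_tendstoD(2)[OF q \<open>s < c\<close>] by (rule eventually_conj)
    then obtain n where n: "x (Suc n) < r" "ereal (ln (x n - x (Suc n)) / ln (x (Suc n))) < c"
      by (auto simp: eventually_sequentially)
    have "x (Suc n) < 1" "x n - x (Suc n) < 1"
      using decr[of n "Suc n"] le1[of n] pos[of "Suc n"] by simp_all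
    then have "part_log_ratio X (cut n) = ereal (ln (x n - x (Suc n)) / ln (x (Suc n)))"
      using pos[of "Suc n"] by (simp add: part_log_ratio_def part_diam_cut part_gap_cut gaps)
    then show ?thesis
      using n clopen_partition_cut[of n] part_diam_cut[of n]
      by (intro Inf_lower2[of "part_log_ratio X (cut n)"] CollectI exI[of _ "cut n"]) auto
  qed
  then have "eventually (\<lambda>r. Inf {part_log_ratio X \<alpha> |\<alpha>. clopen_partition X \<alpha> \<and> part_diam \<alpha> < r} \<le> c)
     (at_right 0)"
    by (auto simp: eventually_at_filter)
  then show "log_ratio X \<le> c"
    by (rule tendsto_upperbound[OF log_ratio_tendsto]) simp
qed

end

section \<open>Construction of a sequence with prescribed gaps\<close>

lemma recursive_null_sequence:
  fixes \<phi> :: "real \<Rightarrow> real"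
  assumes pos: "\<And>y. 0 < y \<Longrightarrow> y \<le> 1 \<Longrightarrow> 0 < \<phi> y"
    and cont: "continuous_on {0<..1} \<phi>"
    and mono: "\<And>y z. 0 < y \<Longrightarrow> y \<le> z \<Longrightarrow> z \<le> 1 \<Longrightarrow> \<phi> y \<le> \<phi> z"
    and lim: "(\<phi> \<longlongrightarrow> 0) (at_right 0)"
  obtains x where "null_sequence x" "\<And>n. x n - x (Suc n) = \<phi> (x (Suc n))"
proof -
  \<comment> \<open>The next term after \<open>z\<close> comes from the intermediate value theorem:
    \<open>y + \<phi> y\<close> is below \<open>z\<close> near 0 and at least \<open>z\<close> at
    \<open>y = z\<close>.\<close>
  have step: "\<exists>y. (0 < y \<and> y \<le> 1) \<and> y + \<phi> y = z" if "0 < z \<and> z \<le> 1" for z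
  proof -
    have "((\<lambda>y. y + \<phi> y) \<longlongrightarrow> 0 + 0) (at_right 0)"
      by (intro tendsto_intros lim)
    then have "eventually (\<lambda>y. y + \<phi> y < z) (at_right 0)"
      using that by (auto dest: order_tendstoD(2))
    moreover have "eventually (\<lambda>y. y \<in> {0<..<z}) (at_right 0)"
      using that by (intro eventually_at_right_real) simp
    ultimately have "eventually (\<lambda>y. y + \<phi> y < z \<and> y \<in> {0<..<z}) (at_right 0)"
      by (rule eventually_conj)
    then obtain a where a: "a + \<phi> a < z" "0 < a" "a < z"
      using eventually_happens'[OF trivial_limit_at_right_real] by fastforce
    have "continuous_on {a..z} (\<lambda>y. y + \<phi> y)"
      by (intro continuous_intros continuous_on_subset[OF cont]) (use a that in auto)
    moreover have "z \<le> z + \<phi> z" using pos[of z] that by simp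
    ultimately obtain y where "a \<le> y" "y \<le> z" "y + \<phi> y = z"
      using IVT'[of "\<lambda>y. y + \<phi> y" a z z] a by (meson less_imp_le)
    then show ?thesis using a that by (intro exI[of _ y]) auto
  qed
  have "\<exists>x. \<forall>n. (0 < x n \<and> x n \<le> 1) \<and> x (Suc n) + \<phi> (x (Suc n)) = x n"
    by (rule dependent_nat_choice) (use step in \<open>auto intro: exI[of _ 1]\<close>)
  then obtain x where x: "\<And>n. 0 < x n" "\<And>n. x n \<le> 1"
    and rec: "\<And>n. x (Suc n) + \<phi> (x (Suc n)) = x n" by blast
  have Suc_less: "x (Suc n) < x n" for n
    using rec[of n] pos[OF x(1)[of "Suc n"] x(2)] by linarith
  then have decr: "x n < x m" if "m < n" for m n
    using lift_Suc_mono_less[of "\<lambda>n. - x n"] that by simp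
  have "decseq x" using Suc_less by (simp add: decseq_SucI less_imp_le)
  then obtain L where L: "x \<longlonglongrightarrow> L" "\<And>n. L \<le> x n"
    using decseq_convergent[of x 0] x(1) less_imp_le by blast
  have "L \<ge> 0" using L(1) x(1) by (meson LIMSEQ_le_const less_imp_le)
  \<comment> \<open>By monotonicity a positive limit would keep all gaps above
    \<open>\<phi> L > 0\<close>, but the gaps of a convergent sequence tend to 0.\<close>
  have "L = 0"
  proof (rule ccontr)
    assume "L \<noteq> 0"
    then have "L > 0" using \<open>L \<ge> 0\<close> by simp
    have "(\<lambda>n. x n - x (Suc n)) \<longlonglongrightarrow> L - L"
      by (intro tendsto_intros L LIMSEQ_Suc)
    moreover have "\<phi> L \<le> x n - x (Suc n)" for n
      using mono[OF \<open>L > 0\<close> L(2)[of "Suc n"] x(2)] rec[of n] by linarith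
    ultimately have "\<phi> L \<le> L - L"
      by (meson LIMSEQ_le_const)
    then show False
      using pos[OF \<open>L > 0\<close>] L(2)[of 0] x(2)[of 0] by simp
  qed
  then have "null_sequence x"
    using decr x L(1) by unfold_locales auto
  moreover have "x n - x (Suc n) = \<phi> (x (Suc n))" for n
    using rec[of n] by linarith
  ultimately show ?thesis by (rule that)
qed

text \<open>The ratios along the constructed sequence are \<open>ln (\<phi> y) / ln y\<close> at
  \<open>y = x (Suc n)\<close>, which tends to 0 from the right. Monotonicity of
  \<open>\<phi>\<close> makes the gaps decrease, as the upper bound requires.\<close>

lemma ex_null_sequence_log_ratio:
  fixes \<phi> :: "real \<Rightarrow> real"
  assumes pos: "\<And>y. 0 < y \<Longrightarrow> y \<le> 1 \<Longrightarrow> 0 < \<phi> y"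
    and cont: "continuous_on {0<..1} \<phi>"
    and mono: "\<And>y z. 0 < y \<Longrightarrow> y \<le> z \<Longrightarrow> z \<le> 1 \<Longrightarrow> \<phi> y \<le> \<phi> z"
    and lim: "(\<phi> \<longlongrightarrow> 0) (at_right 0)"
    and ratio: "((\<lambda>y. ereal (ln (\<phi> y) / ln y)) \<longlongrightarrow> s) (at_right 0)"
  shows "\<exists>x. null_sequence x \<and> log_ratio (insert 0 (range x)) = s"
proof -
  obtain x where "null_sequence x" and gap: "\<And>n. x n - x (Suc n) = \<phi> (x (Suc n))"
    using recursive_null_sequence[OF pos cont mono lim] by blast
  interpret null_sequence x "insert 0 (range x)" by fact simp
  have "filterlim x (at_right 0) sequentially"
    using lim pos by (simp add: tendsto_imp_filterlim_at_right)
  then have "filterlim (\<lambda>n. x (Suc n)) (at_right 0) sequentially"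
    by (rule filterlim_compose) (rule filterlim_Suc)
  then have q: "((\<lambda>n. ereal (ln (x n - x (Suc n)) / ln (x (Suc n)))) \<longlongrightarrow> s) sequentially"
    unfolding gap by (rule filterlim_compose[OF ratio])
  have "x n - x (Suc n) \<le> x k - x (Suc k)" if "k \<le> n" for k n
    unfolding gap using that by (intro mono pos le1) (simp add: le_iff)
  then show ?thesis
    using log_ratio_ge[OF q] log_ratio_le[OF q] \<open>null_sequence x\<close> by (auto intro: antisym)
qed

theorem theorem3p2:
  fixes s :: ereal
  assumes "0 \<le> s"
  shows "\<exists>x :: nat \<Rightarrow> real.
    (\<forall>m n. m < n \<longrightarrow> x n < x m) \<and> (\<forall>n. x n \<in> {0<..1}) \<and> x \<longlonglongrightarrow> 0 \<and>
    (let X = insert 0 (range x) in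
       compact X \<and> countable X \<and> (\<exists>!p. p \<in> X \<and> p islimpt X) \<and> log_ratio X = s)"
proof -
  have "\<exists>x. null_sequence x \<and> log_ratio (insert 0 (range x)) = s"
  proof (cases s)
    case (real t)
    show ?thesis
    proof (cases "t = 0")
      case True
      show ?thesis
      \<comment> \<open>The power \<open>y powr 0\<close> is constantly 1 and does not tend to 0. A
        function vanishing more slowly than every positive power replaces it; the summand 1 keeps
        the denominator at least 1 on \<open>{0<..1}\<close>.\<close>
      proof (rule ex_null_sequence_log_ratio[where \<phi> = "\<lambda>y. 1 / (1 - ln y)"])
        show "continuous_on {0<..1::real} (\<lambda>y. 1 / (1 - ln y))"
        proof (intro continuous_intros ballI)
          show "1 - ln y \<noteq> 0" if "y \<in> {0<..1}" for y :: real
          proof -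
            have "ln y \<le> 0" using that by simp
            then show ?thesis by linarith
          qed
        qed auto
        show "0 < 1 / (1 - ln y)" if "0 < y" "y \<le> 1" for y :: real
        proof -
          have "ln y \<le> 0" using that by simp
          then show ?thesis by simp
        qed
        show "1 / (1 - ln y) \<le> 1 / (1 - ln z)" if "0 < y" "y \<le> z" "z \<le> 1" for y z :: real
        proof -
          have "ln y \<le> ln z" "ln z \<le> 0" using that by simp_all
          then show ?thesis by (intro divide_left_mono) auto
        qed
        show "((\<lambda>y::real. 1 / (1 - ln y)) \<longlongrightarrow> 0) (at_right 0)" by real_asymp
        have "((\<lambda>y::real. ln (1 / (1 - ln y)) / ln y) \<longlongrightarrow> 0) (at_right 0)" by real_asymp
        then show "((\<lambda>y. ereal (ln (1 / (1 - ln y)) / ln y)) \<longlongrightarrow> s) (at_right 0)"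
          using real True by simp
      qed
    next
      case False
      with real assms have t: "t > 0" by simp
      show ?thesis
      \<comment> \<open>Here the ratio equals \<open>t\<close> for every \<open>y\<close> strictly
        between 0 and 1.\<close>
      proof (rule ex_null_sequence_log_ratio[where \<phi> = "\<lambda>y. y powr t"])
        show "continuous_on {0<..1} (\<lambda>y. y powr t)"
          by (intro continuous_intros) auto
        show "((\<lambda>y. y powr t) \<longlongrightarrow> 0) (at_right 0)"
          using t by real_asymp
        have "((\<lambda>y. ln (y powr t) / ln y) \<longlongrightarrow> t) (at_right 0)"
          using t by real_asymp
        then show "((\<lambda>y. ereal (ln (y powr t) / ln y)) \<longlongrightarrow> s) (at_right 0)"
          using real by simp
      qed (use t in \<open>auto intro: powr_mono2\<close>)
    qed
  next
    case PInf
    show ?thesis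
    \<comment> \<open>This vanishes faster than every power: the ratio is
      \<open>- 1 / (y * ln y)\<close>, and \<open>y * ln y\<close> tends to 0 from below.\<close>
    proof (rule ex_null_sequence_log_ratio[where \<phi> = "\<lambda>y. exp (- 1 / y)"])
      show "continuous_on {0<..1::real} (\<lambda>y. exp (- 1 / y))"
        by (intro continuous_intros) auto
      show "exp (- 1 / y) \<le> exp (- 1 / z)" if "0 < y" "y \<le> z" "z \<le> 1" for y z :: real
        using that by (simp add: frac_le)
      show "((\<lambda>y::real. exp (- 1 / y)) \<longlongrightarrow> 0) (at_right 0)" by real_asymp
      have "filterlim (\<lambda>y::real. ln (exp (- 1 / y)) / ln y) at_top (at_right 0)" by real_asymp
      then show "((\<lambda>y. ereal (ln (exp (- 1 / y)) / ln y)) \<longlongrightarrow> s) (at_right 0)"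
        using PInf by (simp add: tendsto_PInfty_eq_at_top)
    qed simp
  next
    case MInf
    with assms show ?thesis by simp
  qed
  then obtain x where "null_sequence x" and R: "log_ratio (insert 0 (range x)) = s" by blast
  interpret null_sequence x "insert 0 (range x)" by fact simp
  have "\<exists>!p. p \<in> insert 0 (range x) \<and> p islimpt insert 0 (range x)"
  proof (rule ex1I[of _ 0])
    show "0 \<in> insert 0 (range x) \<and> 0 islimpt insert 0 (range x)"
      using islimpt_iff[of 0] by simp
    show "p = 0" if "p \<in> insert 0 (range x) \<and> p islimpt insert 0 (range x)" for p
      using that islimpt_iff[of p] by simp
  qed
  then show ?thesis
    unfolding Let_def using decr pos le1 lim compact R
    by (intro exI[of _ x] conjI) simp_all
qed

end
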